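(* Let $M$ and $N$ be nonempty closed bounded convex subsets of a Hilbert space $X$. Let $F:M\cup N\to M\cup N$ satisfy (1) $F(M)\subseteq N$ and $F(N)\subseteq M$; and (2) $\|Fw-Fz\|\le\|w-z\|$ for all $w\in M$, $z\in N$. Let $\epsilon\in(0,1/2)$ and $\eta_n,\delta_n\in(\epsilon,1-\epsilon)$ for $n=0,1,2,\dots$. If $F$ maps $M$ into a compact subset of $N$, then for any $w_0\in M_0$ the sequence defined by $$w_{n+1}=P^n\Big((1-\eta_n)w_n+\eta_nP_M\Big(F\big((1-\delta_n)w_n+\delta_nP_MFw_n\big)\Big)\Big),\qquad n=0,1,2,\dots,$$ converges (in norm) to some $w\in M_0$ such that $\|w-Fw\|=d(M,N)$.
   Context: For subsets $M,N$ of a Hilbert space $X$: $d(M,N)=\inf\{\|w-z\|: w\in M, z\in N\}$ and $M_0=\{w\in M:\|w-z'\|=d(M,N)\text{ for some } z'\in N\}$. For a nonempty closed convex subset $A$ of $X$, $P_A:X\to A$ denotes the metric (nearest point) projection. $P:X\to M$ is defined by $P(w)=P_M(P_N(w))$, and $P^n$ is its $n$-fold iterate ($P^0$ is the identity). The map $F$ is not assumed to be continuous. *)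

theory Defs
  imports "HOL-Analysis.Analysis"
begin

text \<open>For nonempty sets the distance \<open>d(M,N)\<close> is the library's \<^const>\<open>setdist\<close>.\<close>

definition proximal_part :: "'a::real_normed_vector set \<Rightarrow> 'a set \<Rightarrow> 'a set" where
  "proximal_part M N = {w \<in> M. \<exists>z\<in>N. norm (w - z) = setdist M N}"

text \<open>The library's \<^const>\<open>closest_point\<close> requires \<^class>\<open>heine_borel\<close>, which would force the
  space to be finite-dimensional. The definite description below is meaningful when \<open>A\<close> is a
  nonempty closed convex subset of a Hilbert space.\<close>

definition metric_proj :: "'a::real_inner set \<Rightarrow> 'a \<Rightarrow> 'a" where
  "metric_proj A x = (THE y. y \<in> A \<and> (\<forall>z\<in>A. norm (x - y) \<le> norm (x - z)))"

definition alt_proj :: "'a::real_inner set \<Rightarrow> 'a set \<Rightarrow> 'a \<Rightarrow> 'a" where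
  "alt_proj M N w = metric_proj M (metric_proj N w)"

end

theory Submission
  imports Defs
begin

text \<open>
  A convex set contains at most one element of minimal norm, and \<open>N - M\<close> is convex. Hence all
  pairs \<open>(x, z)\<close> in \<open>M \<times> N\<close> that realise the distance of \<open>M\<close> and \<open>N\<close> have the same difference
  \<open>v = z - x\<close> (lemma \<open>gap_vector_unique\<close>). So the proximal part \<open>C\<close> of \<open>M\<close> consists of the points
  \<open>x \<in> M\<close> with \<open>x + v \<in> N\<close>, which makes it closed and convex; on it the projection to \<open>N\<close> is the
  translation by \<open>v\<close>, and the alternating projection \<open>P\<close> is the identity.

  For \<open>x \<in> C\<close> the points \<open>F (x + v) \<in> M\<close> and \<open>F x \<in> N\<close> are at distance at most \<open>norm v\<close>, so they
  again realise the distance, and \<open>F x = F (x + v) + v\<close>. Thus \<open>T x = F x - v\<close> maps \<open>C\<close> to itself and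
  equals the projection of \<open>F x\<close> to \<open>M\<close>. Although \<open>F\<close> is contracting only between \<open>M\<close> and \<open>N\<close>,
  the map \<open>T\<close> is nonexpansive on \<open>C\<close>: with \<open>a = T x - T y\<close> and \<open>b = x - y\<close>, the hypothesis on \<open>F\<close>
  gives \<open>norm (a + v) \<le> norm (b - v)\<close> and, with \<open>x\<close> and \<open>y\<close> exchanged, \<open>norm (a - v) \<le> norm (b + v)\<close>;
  adding the squares gives \<open>norm a \<le> norm b\<close> by the parallelogram law.

  The given recursion is therefore the Ishikawa iteration of a nonexpansive map with relatively
  compact range, and a fixed point \<open>p\<close> of \<open>T\<close> satisfies \<open>F p - p = v\<close>. By
  \<open>ishikawa_step\<close> the squared distance to any fixed point decreases by at least a constant multiple
  of the square of the defect \<open>norm (x - T x)\<close>, so the defect tends to \<open>0\<close>. Compactness yields a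
  cluster point that is fixed by \<open>T\<close> (\<open>approximate_fixed_points_cluster\<close>); as the distance to this
  point is decreasing as well, the whole sequence converges to it.
\<close>

section \<open>Nonexpansive maps with relatively compact range\<close>

lemma norm_convex_combination_sq:
  fixes a b :: "'a::real_inner"
  shows "(norm ((1 - t) *\<^sub>R a + t *\<^sub>R b))\<^sup>2 =
    (1 - t) * (norm a)\<^sup>2 + t * (norm b)\<^sup>2 - t * (1 - t) * (norm (a - b))\<^sup>2"
  unfolding power2_norm_eq_inner
  by (simp add: inner_simps inner_commute algebra_simps)

text \<open>A subsequence of \<open>T (x n)\<close> converges by compactness, and the corresponding \<open>x n\<close> must have the
  same limit because the defects tend to zero; continuity of \<open>T\<close> makes this limit a fixed point. The lemma
  serves both for the existence of fixed points and for the convergence of the iteration.\<close>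

lemma approximate_fixed_points_cluster:
  fixes T :: "'a::real_normed_vector \<Rightarrow> 'a"
  assumes "closed C" and "\<And>n. x n \<in> C"
    and nonexp: "\<And>x y. x \<in> C \<Longrightarrow> y \<in> C \<Longrightarrow> norm (T x - T y) \<le> norm (x - y)"
    and "compact K" "T ` C \<subseteq> K"
    and approx: "(\<lambda>n. x n - T (x n)) \<longlonglongrightarrow> 0"
  obtains p r where "p \<in> C" "T p = p" "strict_mono (r :: nat \<Rightarrow> nat)" "(x \<circ> r) \<longlonglongrightarrow> p"
proof -
  have "\<forall>n. T (x n) \<in> K" using assms by blast
  then obtain p and r :: "nat \<Rightarrow> nat" where r: "strict_mono r" "((\<lambda>n. T (x n)) \<circ> r) \<longlonglongrightarrow> p"
    using \<open>compact K\<close> unfolding compact_def by metis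
  have "(\<lambda>n. x (r n) - T (x (r n))) \<longlonglongrightarrow> 0"
    using LIMSEQ_subseq_LIMSEQ[OF approx r(1)] by (simp add: o_def)
  from tendsto_add[OF this] r(2) have xr: "(\<lambda>n. x (r n)) \<longlonglongrightarrow> p"
    by (fastforce simp: o_def)
  have p: "p \<in> C" using closed_sequentially[OF \<open>closed C\<close> _ xr] assms(2) by blast
  have "(\<lambda>n. norm (x (r n) - p)) \<longlonglongrightarrow> 0"
    using xr by (simp add: LIM_zero tendsto_norm_zero)
  then have "(\<lambda>n. T (x (r n)) - T p) \<longlonglongrightarrow> 0"
    by (rule Lim_null_comparison[rotated]) (simp add: nonexp p assms(2))
  then have "(\<lambda>n. T (x (r n))) \<longlonglongrightarrow> T p"
    by (simp add: LIM_zero_iff)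
  then have "T p = p" using r(2) LIMSEQ_unique by (fastforce simp: o_def)
  with p r xr that show thesis by (simp add: o_def)
qed

text \<open>Averaging \<open>T\<close> with a constant map of small weight turns it into a contraction of \<open>C\<close>. The fixed
  points of these contractions are approximate fixed points of \<open>T\<close>, since the range of \<open>T\<close> is
  bounded.\<close>

lemma nonexpansive_compact_range_fixed_point:
  fixes T :: "'a::real_normed_vector \<Rightarrow> 'a"
  assumes C: "complete C" "convex C" "C \<noteq> {}" and TC: "T ` C \<subseteq> C"
    and nonexp: "\<And>x y. x \<in> C \<Longrightarrow> y \<in> C \<Longrightarrow> norm (T x - T y) \<le> norm (x - y)"
    and K: "compact K" "T ` C \<subseteq> K"
  obtains p where "p \<in> C" "T p = p"
proof -
  obtain x0 where x0: "x0 \<in> C" using C by blast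
  define c where "c n = inverse (real (Suc n))" for n
  have c: "0 < c n" "c n \<le> 1" for n by (auto simp: c_def divide_simps)
  have "\<exists>x\<in>C. c n *\<^sub>R x0 + (1 - c n) *\<^sub>R T x = x" for n
  proof -
    have "\<exists>!x\<in>C. c n *\<^sub>R x0 + (1 - c n) *\<^sub>R T x = x"
    proof (rule Banach_fix[where c="1 - c n"])
      show "(\<lambda>x. c n *\<^sub>R x0 + (1 - c n) *\<^sub>R T x) ` C \<subseteq> C"
        using TC c[of n] x0 by (auto intro!: convexD[OF C(2)])
      show "dist (c n *\<^sub>R x0 + (1 - c n) *\<^sub>R T x) (c n *\<^sub>R x0 + (1 - c n) *\<^sub>R T y)
          \<le> (1 - c n) * dist x y" if "x \<in> C" "y \<in> C" for x y
        using nonexp[OF that] c[of n]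
        by (simp add: dist_norm flip: scaleR_diff_right) (simp add: mult_left_mono)
    qed (use C c[of n] in auto)
    then show ?thesis by blast
  qed
  then obtain x where x: "\<And>n. x n \<in> C" "\<And>n. c n *\<^sub>R x0 + (1 - c n) *\<^sub>R T (x n) = x n"
    by metis
  obtain B where B: "\<And>y. y \<in> K \<Longrightarrow> norm y \<le> B"
    using compact_imp_bounded[OF K(1)] bounded_iff by blast
  have approx: "(\<lambda>n. x n - T (x n)) \<longlonglongrightarrow> 0"
  proof (rule Lim_null_comparison)
    have "norm (x n - T (x n)) \<le> c n * (norm x0 + B)" for n
    proof -
      have "x n - T (x n) = c n *\<^sub>R (x0 - T (x n))"
        by (subst x(2)[symmetric]) (simp add: algebra_simps)
      also have "norm \<dots> \<le> c n * (norm x0 + B)"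
        using c[of n] B[of "T (x n)"] norm_triangle_ineq4[of x0 "T (x n)"] x(1)[of n] K(2)
        by (auto intro!: mult_left_mono)
      finally show ?thesis .
    qed
    then show "\<forall>\<^sub>F n in sequentially. norm (x n - T (x n)) \<le> c n * (norm x0 + B)" by simp
    show "(\<lambda>n. c n * (norm x0 + B)) \<longlonglongrightarrow> 0"
      unfolding c_def using LIMSEQ_inverse_real_of_nat by (rule tendsto_mult_left_zero)
  qed
  show thesis
    by (rule approximate_fixed_points_cluster[OF complete_imp_closed[OF C(1)] x(1) nonexp K approx])
      (assumption | rule that)+
qed

section \<open>The Ishikawa iteration\<close>

text \<open>Both averages are expanded with \<open>norm_convex_combination_sq\<close>. Nonexpansiveness removes
  everything except the negative term of the inner average, which measures how far \<open>x\<close> is from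
  being fixed; the negative term of the outer average is discarded.\<close>

lemma ishikawa_step:
  fixes T :: "'a::real_inner \<Rightarrow> 'a"
  assumes C: "convex C" and TC: "T ` C \<subseteq> C"
    and nonexp: "\<And>x y. x \<in> C \<Longrightarrow> y \<in> C \<Longrightarrow> norm (T x - T y) \<le> norm (x - y)"
    and x: "x \<in> C" and q: "q \<in> C" "T q = q"
    and s: "0 \<le> s" "s \<le> 1" and t: "0 \<le> t" "t \<le> 1"
  shows "(norm ((1 - s) *\<^sub>R x + s *\<^sub>R T ((1 - t) *\<^sub>R x + t *\<^sub>R T x) - q))\<^sup>2
    \<le> (norm (x - q))\<^sup>2 - s * (t * (1 - t)) * (norm (x - T x))\<^sup>2"
proof -
  define y where "y = (1 - t) *\<^sub>R x + t *\<^sub>R T x"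
  have y: "y \<in> C" unfolding y_def using x TC t by (auto intro!: convexD[OF C])
  have comb: "(1 - u) *\<^sub>R a + u *\<^sub>R b - q = (1 - u) *\<^sub>R (a - q) + u *\<^sub>R (b - q)" for u a b
    by (simp add: algebra_simps)
  have "(norm (T y - q))\<^sup>2 \<le> (norm (y - q))\<^sup>2"
    using nonexp[OF y q(1)] q(2) by (simp add: power_mono)
  also have "\<dots> = (1 - t) * (norm (x - q))\<^sup>2 + t * (norm (T x - q))\<^sup>2
      - t * (1 - t) * (norm (x - T x))\<^sup>2"
    unfolding y_def comb norm_convex_combination_sq by simp
  also have "\<dots> \<le> (norm (x - q))\<^sup>2 - t * (1 - t) * (norm (x - T x))\<^sup>2"
  proof -
    have "(norm (T x - q))\<^sup>2 \<le> (norm (x - q))\<^sup>2"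
      using nonexp[OF x q(1)] q(2) by (simp add: power_mono)
    from mult_left_mono[OF this t(1)] show ?thesis by (simp add: algebra_simps)
  qed
  finally have Ty: "(norm (T y - q))\<^sup>2 \<le> (norm (x - q))\<^sup>2 - t * (1 - t) * (norm (x - T x))\<^sup>2" .
  have "(norm ((1 - s) *\<^sub>R x + s *\<^sub>R T y - q))\<^sup>2
      = (1 - s) * (norm (x - q))\<^sup>2 + s * (norm (T y - q))\<^sup>2 - s * (1 - s) * (norm (x - T y))\<^sup>2"
    unfolding comb norm_convex_combination_sq by simp
  also have "\<dots> \<le> (1 - s) * (norm (x - q))\<^sup>2 + s * (norm (T y - q))\<^sup>2"
    using s by simp
  also have "\<dots> \<le> (norm (x - q))\<^sup>2 - s * (t * (1 - t)) * (norm (x - T x))\<^sup>2"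
    using mult_left_mono[OF Ty s(1)] by (simp add: algebra_simps)
  finally show ?thesis unfolding y_def .
qed

text \<open>The recursion is required only at points of \<open>C\<close>, because a recursion involving further
  projections may take this form only there.\<close>

lemma ishikawa_iteration_converges:
  fixes T :: "'a::real_inner \<Rightarrow> 'a"
  assumes C: "complete C" "convex C" and TC: "T ` C \<subseteq> C"
    and nonexp: "\<And>x y. x \<in> C \<Longrightarrow> y \<in> C \<Longrightarrow> norm (T x - T y) \<le> norm (x - y)"
    and K: "compact K" "T ` C \<subseteq> K"
    and \<epsilon>: "0 < \<epsilon>" and s: "\<And>n. s n \<in> {\<epsilon>..1 - \<epsilon>}" and t: "\<And>n. t n \<in> {\<epsilon>..1 - \<epsilon>}"
    and x0: "x 0 \<in> C"
    and step: "\<And>n. x n \<in> C \<Longrightarrow>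
      x (Suc n) = (1 - s n) *\<^sub>R x n + s n *\<^sub>R T ((1 - t n) *\<^sub>R x n + t n *\<^sub>R T (x n))"
  obtains p where "p \<in> C" "T p = p" "x \<longlonglongrightarrow> p"
proof -
  have s01: "0 \<le> s n" "s n \<le> 1" and t01: "0 \<le> t n" "t n \<le> 1" for n
    using s[of n] t[of n] \<epsilon> by auto
  have xC: "x n \<in> C" for n
  proof (induction n)
    case (Suc n)
    then have "(1 - t n) *\<^sub>R x n + t n *\<^sub>R T (x n) \<in> C"
      using TC t01[of n] by (auto intro!: convexD[OF C(2)])
    then show ?case
      unfolding step[OF Suc] using Suc TC s01[of n] by (auto intro!: convexD[OF C(2)])
  qed (rule x0)
  have decr: "(norm (x (Suc n) - q))\<^sup>2 \<le> (norm (x n - q))\<^sup>2 - \<epsilon> ^ 3 * (norm (x n - T (x n)))\<^sup>2"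
    if q: "q \<in> C" "T q = q" for q n
  proof -
    have "\<epsilon> * (\<epsilon> * \<epsilon>) \<le> s n * (t n * (1 - t n))"
      using s[of n] t[of n] \<epsilon> by (intro mult_mono) auto
    then have "\<epsilon> ^ 3 * (norm (x n - T (x n)))\<^sup>2 \<le> s n * (t n * (1 - t n)) * (norm (x n - T (x n)))\<^sup>2"
      by (intro mult_right_mono) (auto simp: power3_eq_cube)
    then show ?thesis
      using ishikawa_step[OF C(2) TC nonexp xC q s01 t01, of n n n]
      unfolding step[OF xC] by linarith
  qed
  have fejer: "decseq (\<lambda>n. (norm (x n - q))\<^sup>2)" if q: "q \<in> C" "T q = q" for q
    unfolding decseq_Suc_iff
  proof
    fix n
    have "0 \<le> \<epsilon> ^ 3 * (norm (x n - T (x n)))\<^sup>2" using \<epsilon> by simp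
    then show "(norm (x (Suc n) - q))\<^sup>2 \<le> (norm (x n - q))\<^sup>2"
      using decr[OF q, of n] by linarith
  qed
  \<comment> \<open>Any fixed point shows that the defects tend to zero: up to a constant factor, their squares are
    bounded by the decrements of a convergent sequence.\<close>
  obtain q where q: "q \<in> C" "T q = q"
    using nonexpansive_compact_range_fixed_point[OF C _ TC nonexp K] x0 by blast
  obtain L where L: "(\<lambda>n. (norm (x n - q))\<^sup>2) \<longlonglongrightarrow> L"
    using decseq_convergent[OF fejer[OF q], of 0] by auto
  have "(\<lambda>n. ((norm (x n - q))\<^sup>2 - (norm (x (Suc n) - q))\<^sup>2) / \<epsilon> ^ 3) \<longlonglongrightarrow> (L - L) / \<epsilon> ^ 3"
    using \<epsilon> by (intro tendsto_intros L LIMSEQ_Suc[OF L]) auto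
  then have gap: "(\<lambda>n. ((norm (x n - q))\<^sup>2 - (norm (x (Suc n) - q))\<^sup>2) / \<epsilon> ^ 3) \<longlonglongrightarrow> 0" by simp
  have "(\<lambda>n. (norm (x n - T (x n)))\<^sup>2) \<longlonglongrightarrow> 0"
  proof (rule Lim_null_comparison[OF _ gap], rule always_eventually, rule allI)
    fix n
    show "norm ((norm (x n - T (x n)))\<^sup>2)
        \<le> ((norm (x n - q))\<^sup>2 - (norm (x (Suc n) - q))\<^sup>2) / \<epsilon> ^ 3"
      using decr[OF q, of n] \<epsilon> by (simp add: field_simps)
  qed
  from tendsto_real_sqrt[OF this] have approx: "(\<lambda>n. x n - T (x n)) \<longlonglongrightarrow> 0"
    by (simp add: tendsto_norm_zero_iff)
  \<comment> \<open>The limit has to be compared with the fixed point that is a cluster point of \<open>x\<close>, which need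
    not be \<open>q\<close>.\<close>
  obtain p r where p: "p \<in> C" "T p = p" and r: "strict_mono (r :: nat \<Rightarrow> nat)" "(x \<circ> r) \<longlonglongrightarrow> p"
    by (rule approximate_fixed_points_cluster[OF complete_imp_closed[OF C(1)] xC nonexp K approx])
  obtain l where l: "(\<lambda>n. (norm (x n - p))\<^sup>2) \<longlonglongrightarrow> l"
    using decseq_convergent[OF fejer[OF p], of 0] by auto
  have "(\<lambda>n. (norm ((x \<circ> r) n - p))\<^sup>2) \<longlonglongrightarrow> (norm (p - p))\<^sup>2"
    by (intro tendsto_intros r)
  moreover have "(\<lambda>n. (norm ((x \<circ> r) n - p))\<^sup>2) \<longlonglongrightarrow> l"
    using LIMSEQ_subseq_LIMSEQ[OF l r(1)] by (simp add: o_def)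
  ultimately have "(norm (p - p))\<^sup>2 = l" by (rule LIMSEQ_unique)
  then have "l = 0" by simp
  with l have "(\<lambda>n. sqrt ((norm (x n - p))\<^sup>2)) \<longlonglongrightarrow> sqrt 0"
    using tendsto_real_sqrt by blast
  then have "x \<longlonglongrightarrow> p"
    by (simp add: tendsto_norm_zero_iff LIM_zero_iff)
  with p that show thesis by blast
qed

section \<open>Pairs realising the distance of two convex sets\<close>

text \<open>If two difference vectors of minimal norm were distinct, the difference vector of the
  midpoints would be strictly shorter.\<close>

lemma gap_vector_unique:
  fixes M N :: "'a::real_inner set"
  assumes "convex M" "convex N"
    and x: "x \<in> M" "x' \<in> M" and z: "z \<in> N" "z' \<in> N"
    and d: "norm (x - z) = setdist M N" "norm (x' - z') = setdist M N"
  shows "z - x = z' - x'"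
proof -
  let ?h = "1 / 2 :: real"
  have "(1 - ?h) *\<^sub>R x + ?h *\<^sub>R x' \<in> M" "(1 - ?h) *\<^sub>R z + ?h *\<^sub>R z' \<in> N"
    by (intro convexD[OF assms(1)] convexD[OF assms(2)] x z; simp)+
  from setdist_le_dist[OF this]
  have "setdist M N \<le> norm ((1 - ?h) *\<^sub>R (x - z) + ?h *\<^sub>R (x' - z'))"
    by (simp add: dist_norm algebra_simps)
  then have "(setdist M N)\<^sup>2 \<le> (norm ((1 - ?h) *\<^sub>R (x - z) + ?h *\<^sub>R (x' - z')))\<^sup>2"
    by (rule power_mono) (rule setdist_pos_le)
  also have "\<dots> = (setdist M N)\<^sup>2 - (norm ((x - z) - (x' - z')))\<^sup>2 / 4"
    unfolding norm_convex_combination_sq d by simp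
  finally have "(norm ((x - z) - (x' - z')))\<^sup>2 \<le> 0" by simp
  then show ?thesis by (simp add: algebra_simps)
qed

lemma metric_proj_of_proximal_pair:
  fixes M N :: "'a::real_inner set"
  assumes "convex M" "convex N" "x \<in> M" "z \<in> N" "norm (x - z) = setdist M N"
  shows "metric_proj N x = z"
  unfolding metric_proj_def
proof (rule the_equality)
  show "z \<in> N \<and> (\<forall>y\<in>N. norm (x - z) \<le> norm (x - y))"
    using assms setdist_le_dist[of x M _ N] by (auto simp: dist_norm)
  fix y assume y: "y \<in> N \<and> (\<forall>y'\<in>N. norm (x - y) \<le> norm (x - y'))"
  then have "norm (x - y) = setdist M N"
    using assms setdist_le_dist[of x M y N] by (force simp: dist_norm)
  then have "y - x = z - x"
    using y by (intro gap_vector_unique[OF assms(1,2) assms(3,3) _ assms(4) _ assms(5)]) auto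
  then show "y = z" by simp
qed

section \<open>Convergence to a best proximity point\<close>

theorem corollary2p5:
  fixes M N :: "'a::{real_inner, complete_space} set"
    and F :: "'a \<Rightarrow> 'a"
    and \<epsilon> :: real
    and \<eta> \<delta> :: "nat \<Rightarrow> real"
    and w :: "nat \<Rightarrow> 'a"
  assumes "M \<noteq> {}" "closed M" "bounded M" "convex M"
    and "N \<noteq> {}" "closed N" "bounded N" "convex N"
    and "F ` (M \<union> N) \<subseteq> M \<union> N"
    and "F ` M \<subseteq> N" "F ` N \<subseteq> M"
    and "\<And>x z. x \<in> M \<Longrightarrow> z \<in> N \<Longrightarrow> norm (F x - F z) \<le> norm (x - z)"
    and "\<epsilon> \<in> {0<..<1/2}"
    and "\<And>n. \<eta> n \<in> {\<epsilon><..<1 - \<epsilon>}"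
    and "\<And>n. \<delta> n \<in> {\<epsilon><..<1 - \<epsilon>}"
    and "\<exists>K. compact K \<and> K \<subseteq> N \<and> F ` M \<subseteq> K"
    and "w 0 \<in> proximal_part M N"
    and "\<And>n. w (Suc n) =
      (alt_proj M N ^^ n)
        ((1 - \<eta> n) *\<^sub>R w n +
         \<eta> n *\<^sub>R metric_proj M
           (F ((1 - \<delta> n) *\<^sub>R w n + \<delta> n *\<^sub>R metric_proj M (F (w n)))))"
  shows "\<exists>p \<in> proximal_part M N. w \<longlonglongrightarrow> p \<and> norm (p - F p) = setdist M N"
proof -
  let ?d = "setdist M N"
  note M = assms(1-4) and N = assms(5-8) and lip = assms(12)
  have FM: "F x \<in> N" if "x \<in> M" for x using that assms(10) by blast
  have FN: "F x \<in> M" if "x \<in> N" for x using that assms(11) by blast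
  obtain K where K: "compact K" "F ` M \<subseteq> K" using assms(16) by blast
  have w0: "w 0 \<in> M" and "\<exists>z\<in>N. norm (w 0 - z) = ?d"
    using assms(17) by (auto simp: proximal_part_def)
  then obtain z0 where z0: "z0 \<in> N" "norm (w 0 - z0) = ?d" by blast
  \<comment> \<open>The starting point is proximal, so it provides the minimal vector \<open>v\<close> of \<open>N - M\<close>.\<close>
  define v where "v = z0 - w 0"
  have nv: "norm v = ?d" using z0(2) by (simp add: v_def norm_minus_commute)
  define C where "C = {x \<in> M. x + v \<in> N}"
  have gap: "z = x + v" if "x \<in> M" "z \<in> N" "norm (x - z) = ?d" for x z
    using gap_vector_unique[OF M(4) N(4) that(1) w0 that(2) z0(1) that(3) z0(2)]
    by (simp add: v_def algebra_simps)
  have C_eq: "C = proximal_part M N"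
    unfolding C_def proximal_part_def using gap nv by force
  have projM: "metric_proj M (x + v) = x" if "x \<in> C" for x
    by (rule metric_proj_of_proximal_pair[of N])
      (use that M N nv in \<open>auto simp: C_def setdist_sym\<close>)
  have projN: "metric_proj N x = x + v" if "x \<in> C" for x
    by (rule metric_proj_of_proximal_pair[of M])
      (use that M N nv in \<open>auto simp: C_def\<close>)
  have alt: "(alt_proj M N ^^ n) x = x" if "x \<in> C" for n x
    by (induction n) (auto simp: alt_proj_def projM projN that)

  define T where "T x = F x - v" for x
  have FC: "F (x + v) = T x" "T x \<in> C" if "x \<in> C" for x
  proof -
    have x: "x \<in> M" "x + v \<in> N" using that by (auto simp: C_def)
    have "norm (F (x + v) - F x) \<le> ?d"
      using lip[OF x] nv by (simp add: norm_minus_commute)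
    moreover have "?d \<le> norm (F (x + v) - F x)"
      using setdist_le_dist[OF FN[OF x(2)] FM[OF x(1)]] by (simp add: dist_norm)
    ultimately have "F x = F (x + v) + v"
      by (intro gap FN FM x) auto
    then show "F (x + v) = T x" by (simp add: T_def)
    with FN[OF x(2)] FM[OF x(1)] show "T x \<in> C" by (auto simp: C_def T_def)
  qed
  have projF: "metric_proj M (F x) = T x" if "x \<in> C" for x
    using projM[OF FC(2)[OF that]] by (simp add: T_def)
  have nonexp: "norm (T x - T y) \<le> norm (x - y)" if "x \<in> C" "y \<in> C" for x y
  proof -
    \<comment> \<open>The hypothesis on \<open>F\<close> compares \<open>x \<in> M\<close> with \<open>y + v \<in> N\<close>.\<close>
    have half: "(norm ((T x - T y) + v))\<^sup>2 \<le> (norm ((x - y) - v))\<^sup>2" if "x \<in> C" "y \<in> C" for x y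
    proof -
      have "norm (F x - F (y + v)) \<le> norm (x - (y + v))"
        using that by (intro lip) (auto simp: C_def)
      also have "F x - F (y + v) = (T x - T y) + v"
        unfolding FC(1)[OF that(2)] by (simp add: T_def)
      finally show ?thesis by (intro power_mono) (auto simp: algebra_simps)
    qed
    have "(norm (T x - T y))\<^sup>2 \<le> (norm (x - y))\<^sup>2"
      \<comment> \<open>In the sum of both instances the inner products with \<open>v\<close> cancel.\<close>
      using half[OF that] half[OF that(2,1)]
      by (simp add: power2_norm_eq_inner inner_add_left inner_add_right inner_diff_left
          inner_diff_right inner_commute)
    then show ?thesis by (rule power2_le_imp_le) simp
  qed

  have "closed ((\<lambda>x. x + v) -` N)"
    using N by (intro continuous_closed_vimage) (auto intro: continuous_intros)
  then have comp: "complete C"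
    using M unfolding complete_eq_closed C_def by (simp add: closed_Int Collect_conj_eq vimage_def)
  have conv: "convex C"
    unfolding convex_alt
  proof (intro ballI allI impI)
    fix x y and u :: real assume *: "x \<in> C" "y \<in> C" "0 \<le> u \<and> u \<le> 1"
    have "(1 - u) *\<^sub>R (x + v) + u *\<^sub>R (y + v) \<in> N"
      using * by (intro convexD[OF N(4)]) (auto simp: C_def)
    also have "(1 - u) *\<^sub>R (x + v) + u *\<^sub>R (y + v) = ((1 - u) *\<^sub>R x + u *\<^sub>R y) + v"
      by (simp add: algebra_simps)
    finally show "(1 - u) *\<^sub>R x + u *\<^sub>R y \<in> C"
      using * by (auto simp: C_def intro!: convexD[OF M(4)])
  qed
  have TC: "T ` C \<subseteq> C" using FC(2) by blast
  have TK: "compact ((\<lambda>y. y - v) ` K)" "T ` C \<subseteq> (\<lambda>y. y - v) ` K"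
    using K by (auto simp: T_def C_def intro!: compact_continuous_image continuous_intros)
  have \<epsilon>: "0 < \<epsilon>" using assms(13) by simp
  have \<eta>: "\<eta> n \<in> {\<epsilon>..1 - \<epsilon>}" and \<delta>: "\<delta> n \<in> {\<epsilon>..1 - \<epsilon>}" for n
    using assms(14)[of n] assms(15)[of n] by auto
  have step: "w (Suc n) = (1 - \<eta> n) *\<^sub>R w n
      + \<eta> n *\<^sub>R T ((1 - \<delta> n) *\<^sub>R w n + \<delta> n *\<^sub>R T (w n))" if "w n \<in> C" for n
  proof -
    let ?y = "(1 - \<delta> n) *\<^sub>R w n + \<delta> n *\<^sub>R T (w n)"
    have y: "?y \<in> C"
      using that FC(2) \<delta>[of n] \<epsilon> by (intro convexD[OF conv]) auto
    then have "(1 - \<eta> n) *\<^sub>R w n + \<eta> n *\<^sub>R T ?y \<in> C"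
      using that FC(2) \<eta>[of n] \<epsilon> by (intro convexD[OF conv]) auto
    then show ?thesis
      unfolding assms(18)[of n] projF[OF that] projF[OF y] by (rule alt)
  qed
  have w0C: "w 0 \<in> C" using assms(17) unfolding C_eq .
  obtain p where p: "p \<in> C" "T p = p" "w \<longlonglongrightarrow> p"
    by (rule ishikawa_iteration_converges[where C = C and T = T and x = w and s = \<eta> and t = \<delta>,
          OF comp conv TC nonexp TK \<epsilon> \<eta> \<delta> w0C step])
  have "F p = p + v" using p(2) by (simp add: T_def algebra_simps)
  then have "norm (p - F p) = ?d" by (simp add: nv)
  with p show ?thesis unfolding C_eq by blast
qed

end
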